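(* Consider the system $x^+=f(x,u,w)$, stage cost $\ell$, steady-state pair $(x_s,u_s)$, horizon $N\ge 1$, terminal set $\mathbb{X}_f\subseteq\mathbb{X}$, terminal cost $V_f:\mathbb{X}\to\mathbb{R}$, feasible set $\mathcal{X}$, and economic MPC control law $\kappa:\mathcal{X}\to\mathbb{U}$ described in the context. Suppose the following two groups of assumptions hold. (A) The functions $f:\mathbb{X}\times\mathbb{U}\times\mathbb{W}\to\mathbb{X}$ and $\ell:\mathbb{X}\times\mathbb{U}\to\mathbb{R}$ are continuous; $\mathbb{U}$ is compact, $\mathbb{X}$ is closed, and $\mathcal{X}$ is bounded; and $(x_s,u_s)\in\mathbb{X}\times\mathbb{U}$ satisfies $x_s=f(x_s,u_s,0)$. (B) There exist a set $\mathbb{X}_s\subseteq\mathbb{X}$ with $x_s\in\mathbb{X}_s$, a terminal control law $\kappa_f:\mathbb{X}_s\to\mathbb{U}$ such that $\mathbb{X}_s$ is positive invariant for $x^+=f(x,\kappa_f(x),0)$, and a continuous function $V_s:\mathbb{X}\to\mathbb{R}_{\ge 0}$ that is a Lyapunov function for $x^+=f(x,\kappa_f(x),0)$ on $\mathbb{X}_s$ with respect to the steady state $x_s$. The terminal set is $\mathbb{X}_f=\{x\in\mathbb{X}\mid V_s(x)\le\tau\}$, with $\tau>0$ chosen such that $\mathbb{X}_f\subseteq\mathbb{X}_s$. The function $V_f:\mathbb{X}\to\mathbb{R}$ is continuous and satisfies $$V_f(f(x,\kappa_f(x),0))\le V_f(x)-\ell(x,\kappa_f(x))+\ell(x_s,u_s)\qquad\text{for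 all }x\in\mathbb{X}_f.$$ Then there exist $\delta>0$ and $\gamma(\cdot)\in\mathcal{K}$ such that $\mathcal{X}$ is robustly positive invariant for $x^+=f(x,\kappa(x),w)$ with $w\in\{w\in\mathbb{W}\mid |w|\le\delta\}$, and $$\limsup_{T\to\infty}\frac1T\sum_{k=0}^{T-1}\ell(x(k),u(k))\le \ell(x_s,u_s)+\gamma(\lVert\mathbf{w}_\infty\rVert),$$ in which $x(k)=\phi(k;x,\mathbf{w}_\infty)$ and $u(k)=\kappa(x(k))$, for all $x\in\mathcal{X}$ and all $\mathbf{w}_\infty\in\{w\in\mathbb{W}\mid |w|\le\delta\}^\infty$.
   Context: System: $x^+=f(x,u,w)$ with $f:\mathbb{X}\times\mathbb{U}\times\mathbb{W}\to\mathbb{X}$, state $x\in\mathbb{X}\subseteq\mathbb{R}^n$, input $u\in\mathbb{U}\subseteq\mathbb{R}^m$, disturbance $w\in\mathbb{W}\subseteq\mathbb{R}^q$, $0\in\mathbb{W}$. $|\cdot|$ is the Euclidean norm. Stage cost: $\ell(x,u)=\ell_e(x,u)+\lambda\max\{g(x,u),0\}$, with $\ell_e:\mathbb{X}\times\mathbb{U}\to\mathbb{R}$ an economic cost (not assumed sign-definite), $g:\mathbb{X}\times\mathbb{U}\to\mathbb{R}$ continuous, and $\lambda>0$. Nominal prediction: for $\mathbf{u}=(u(0),\dots,u(N-1))\in\mathbb{U}^N$, $\hat\phi(k;x,\mathbf{u})$, $k\in\{0,\dots,N\}$, is the state at time $k$ of the nominal system $x^+=f(x,u,0)$ from initial state $x\in\mathbb{X}$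 under $\mathbf{u}$. MPC problem: given $\mathbb{X}_f\subseteq\mathbb{X}$ and $V_f:\mathbb{X}\to\mathbb{R}$, define $\mathcal{U}(x):=\{\mathbf{u}\in\mathbb{U}^N\mid\hat\phi(N;x,\mathbf{u})\in\mathbb{X}_f\}$, $\mathcal{X}:=\{x\in\mathbb{X}\mid\mathcal{U}(x)\ne\emptyset\}$, $V(x,\mathbf{u}):=\sum_{k=0}^{N-1}\ell(\hat\phi(k;x,\mathbf{u}),u(k))+V_f(\hat\phi(N;x,\mathbf{u}))$, $V^0(x):=\min_{\mathbf{u}\in\mathcal{U}(x)}V(x,\mathbf{u})$. For $x\in\mathcal{X}$, $\mathbf{u}^0(x)$ denotes a (selected) minimizer in $\arg\min_{\mathbf{u}\in\mathcal{U}(x)}V(x,\mathbf{u})$, and $\kappa(x):=u^0(0;x)$ is its first input. Closed loop: $\phi(k;x,\mathbf{w}_\infty)$ is the state at time $k\ge0$ of $x^+=f(x,\kappa(x),w)$ from initial state $x\in\mathcal{X}$ under the disturbance sequence $\mathbf{w}_\infty=(w(0),w(1),\dots)$, and $\lVert\mathbf{w}_\infty\rVert:=\sup_{k\ge0}|w(k)|$. Definitions. $\alpha:\mathbb{R}_{\ge0}\to\mathbb{R}_{\ge0}$ is in class $\mathcal{K}$ if it is continuous, strictly increasing and $\alpha(0)=0$; it is in class $\mathcal{K}_\infty$ if in addition $\lim_{s\to\infty}\alpha(s)=\infty$. A set $X$ is positive invariant for $x^+=f(x)$ if $f(x)\in X$ for all $x\in X$. A set $X$ is robustly positive invariant for $x^+=f(x,w)$,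 $w\in W$, if $f(x,w)\in X$ for all $x\in X$, $w\in W$. A function $V\ge 0$ is a Lyapunov function for $x^+=f(x)$ on the positive invariant set $X$ with respect to the steady state $x_s$ if there exist $\alpha_1,\alpha_2,\alpha_3\in\mathcal{K}_\infty$ such that $\alpha_1(|x-x_s|)\le V(x)\le\alpha_2(|x-x_s|)$ and $V(f(x))\le V(x)-\alpha_3(|x-x_s|)$ for all $x\in X$. *)

theory Defs
  imports "HOL-Analysis.Analysis"
begin

text \<open>
  Functions on a subset of a Euclidean space are total HOL functions; their domains and codomains
  are imposed by hypotheses. Comparison functions are only constrained on \<open>{0..}\<close>; that they are
  nonnegative there follows from the conditions below.
\<close>

definition class_K :: "(real \<Rightarrow> real) \<Rightarrow> bool" where
  "class_K \<alpha> \<longleftrightarrow> continuous_on {0..} \<alpha> \<and> strict_mono_on {0..} \<alpha> \<and> \<alpha> 0 = 0"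

definition class_K_inf :: "(real \<Rightarrow> real) \<Rightarrow> bool" where
  "class_K_inf \<alpha> \<longleftrightarrow> class_K \<alpha> \<and> filterlim \<alpha> at_top at_top"

definition positive_invariant :: "'a set \<Rightarrow> ('a \<Rightarrow> 'a) \<Rightarrow> bool" where
  "positive_invariant S F \<longleftrightarrow> (\<forall>x\<in>S. F x \<in> S)"

definition robustly_positive_invariant :: "'a set \<Rightarrow> 'w set \<Rightarrow> ('a \<Rightarrow> 'w \<Rightarrow> 'a) \<Rightarrow> bool" where
  "robustly_positive_invariant S D F \<longleftrightarrow> (\<forall>x\<in>S. \<forall>w\<in>D. F x w \<in> S)"

definition lyapunov_function ::
  "('a::real_normed_vector \<Rightarrow> real) \<Rightarrow> ('a \<Rightarrow> 'a) \<Rightarrow> 'a set \<Rightarrow> 'a \<Rightarrow> bool" where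
  "lyapunov_function V F S xs \<longleftrightarrow>
     positive_invariant S F \<and> (\<forall>x\<in>S. 0 \<le> V x) \<and>
     (\<exists>\<alpha>1 \<alpha>2 \<alpha>3. class_K_inf \<alpha>1 \<and> class_K_inf \<alpha>2 \<and> class_K_inf \<alpha>3 \<and>
        (\<forall>x\<in>S. \<alpha>1 (norm (x - xs)) \<le> V x \<and> V x \<le> \<alpha>2 (norm (x - xs)) \<and>
               V (F x) \<le> V x - \<alpha>3 (norm (x - xs))))"

definition stage_cost ::
  "('x \<Rightarrow> 'u \<Rightarrow> real) \<Rightarrow> real \<Rightarrow> ('x \<Rightarrow> 'u \<Rightarrow> real) \<Rightarrow> 'x \<Rightarrow> 'u \<Rightarrow> real" where
  "stage_cost le lam g x u = le x u + lam * max (g x u) 0"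

primrec nominal_state ::
  "('x \<Rightarrow> 'u \<Rightarrow> 'w::zero \<Rightarrow> 'x) \<Rightarrow> 'x \<Rightarrow> (nat \<Rightarrow> 'u) \<Rightarrow> nat \<Rightarrow> 'x" where
  "nominal_state f x us 0 = x"
| "nominal_state f x us (Suc k) = f (nominal_state f x us k) (us k) 0"

text \<open>
  The set of \<open>N\<close>-tuples over \<open>U\<close> is the set \<open>{..<N} \<rightarrow>\<^sub>E U\<close> of functions that are
  \<open>undefined\<close> outside \<open>{..<N}\<close>.
\<close>

definition feasible_inputs ::
  "('x \<Rightarrow> 'u \<Rightarrow> 'w::zero \<Rightarrow> 'x) \<Rightarrow> 'u set \<Rightarrow> nat \<Rightarrow> 'x set \<Rightarrow> 'x \<Rightarrow> (nat \<Rightarrow> 'u) set" where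
  "feasible_inputs f U N Xf x = {us \<in> {..<N} \<rightarrow>\<^sub>E U. nominal_state f x us N \<in> Xf}"

definition feasible_set ::
  "('x \<Rightarrow> 'u \<Rightarrow> 'w::zero \<Rightarrow> 'x) \<Rightarrow> 'x set \<Rightarrow> 'u set \<Rightarrow> nat \<Rightarrow> 'x set \<Rightarrow> 'x set" where
  "feasible_set f X U N Xf = {x \<in> X. feasible_inputs f U N Xf x \<noteq> {}}"

definition mpc_cost ::
  "('x \<Rightarrow> 'u \<Rightarrow> 'w::zero \<Rightarrow> 'x) \<Rightarrow> ('x \<Rightarrow> 'u \<Rightarrow> real) \<Rightarrow> ('x \<Rightarrow> real) \<Rightarrow> nat \<Rightarrow>
   'x \<Rightarrow> (nat \<Rightarrow> 'u) \<Rightarrow> real" where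
  "mpc_cost f l Vf N x us =
     (\<Sum>k<N. l (nominal_state f x us k) (us k)) + Vf (nominal_state f x us N)"

text \<open>\<open>u0\<close> selects an optimal input sequence at every feasible state.\<close>

definition optimal_selection ::
  "('x \<Rightarrow> 'u \<Rightarrow> 'w::zero \<Rightarrow> 'x) \<Rightarrow> 'x set \<Rightarrow> 'u set \<Rightarrow> nat \<Rightarrow> 'x set \<Rightarrow>
   ('x \<Rightarrow> 'u \<Rightarrow> real) \<Rightarrow> ('x \<Rightarrow> real) \<Rightarrow> ('x \<Rightarrow> nat \<Rightarrow> 'u) \<Rightarrow> bool" where
  "optimal_selection f X U N Xf l Vf u0 \<longleftrightarrow>
     (\<forall>x\<in>feasible_set f X U N Xf.
        is_arg_min (mpc_cost f l Vf N x) (\<lambda>us. us \<in> feasible_inputs f U N Xf x) (u0 x))"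

primrec closed_loop_state ::
  "('x \<Rightarrow> 'u \<Rightarrow> 'w \<Rightarrow> 'x) \<Rightarrow> ('x \<Rightarrow> 'u) \<Rightarrow> 'x \<Rightarrow> (nat \<Rightarrow> 'w) \<Rightarrow> nat \<Rightarrow> 'x" where
  "closed_loop_state f \<kappa> x w 0 = x"
| "closed_loop_state f \<kappa> x w (Suc k) =
     f (closed_loop_state f \<kappa> x w k) (\<kappa> (closed_loop_state f \<kappa> x w k)) (w k)"

text \<open>The supremum is over reals, hence meaningful only for bounded sequences.\<close>

definition sup_norm :: "(nat \<Rightarrow> 'w::real_normed_vector) \<Rightarrow> real" where
  "sup_norm w = (SUP k. norm (w k))"

end

theory Submission
  imports Defs
begin

text \<open>
  At a feasible state, drop the first optimal input and append the terminal control law. On the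
  terminal set the Lyapunov decrease is bounded away from zero near the level \<open>\<tau>\<close>, so the
  nominal successor reaches the terminal set with a uniform margin, which small disturbances cannot
  use up; this is robust recursive feasibility. By the terminal cost inequality, the optimal cost
  decreases along the closed loop by the stage cost minus its steady-state value, up to an error
  that tends to zero uniformly with the disturbance and hence has a class-K bound. The optimal cost
  is bounded on the feasible set, so telescoping yields the average bound. All uniformity comes from
  compactness in states and inputs and continuity at zero disturbance.
\<close>

section \<open>Class-K majorants\<close>

text \<open>Smallness near zero and the bound \<open>M\<close> give, for each intercept
  \<open>e\<close>, a line on or above all points \<open>(s i, v i)\<close>. The lower envelope of
  these lines vanishes at zero; adding the identity makes it strictly increasing.\<close>

lemma class_K_majorant:
  fixes s v :: "'i \<Rightarrow> real"
  assumes s_nonneg: "\<And>i. i \<in> I \<Longrightarrow> 0 \<le> s i"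
    and v_le: "\<And>i. i \<in> I \<Longrightarrow> v i \<le> M"
    and v_small: "\<And>e. 0 < e \<Longrightarrow> \<exists>d>0. \<forall>i\<in>I. s i \<le> d \<longrightarrow> v i \<le> e"
  shows "\<exists>\<gamma>. class_K \<gamma> \<and> (\<forall>i\<in>I. v i \<le> \<gamma> (s i))"
proof -
  have "\<exists>L\<ge>0. \<forall>i\<in>I. v i \<le> e + L * s i" if "0 < e" for e
  proof -
    obtain d where d: "d > 0" "\<And>i. i \<in> I \<Longrightarrow> s i \<le> d \<Longrightarrow> v i \<le> e"
      using v_small[OF \<open>0 < e\<close>] by blast
    \<comment> \<open>Beyond \<open>d\<close> the slope lifts the line above
      \<open>\<bar>M\<bar>\<close>; the absolute value keeps the slope nonnegative.\<close>
    have "v i \<le> e + \<bar>M\<bar> / d * s i" if i: "i \<in> I" for i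
    proof (cases "s i \<le> d")
      case True
      then show ?thesis
        using d(2)[OF i] s_nonneg[OF i] d(1) by (smt (verit) divide_nonneg_pos mult_nonneg_nonneg)
    next
      case False
      then have "\<bar>M\<bar> / d * d \<le> \<bar>M\<bar> / d * s i"
        using d(1) by (intro mult_left_mono) auto
      then show ?thesis
        using v_le[OF i] d(1) \<open>0 < e\<close> by simp
    qed
    then show ?thesis
      using d(1) by (intro exI[of _ "\<bar>M\<bar> / d"]) auto
  qed
  then obtain L where L: "\<And>e. 0 < e \<Longrightarrow> 0 \<le> L e"
      "\<And>e i. 0 < e \<Longrightarrow> i \<in> I \<Longrightarrow> v i \<le> e + L e * s i"
    by metis
  txt \<open>An infimum of increasing affine functions is concave, hence continuous on \<open>{0<..}\<close>.
    Continuity is obtained below from monotonicity and \<open>G t \<le> t / r * G r\<close>.\<close>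
  define G where "G t = (INF e\<in>{0<..}. e + L e * t)" for t
  have bdd: "bdd_below ((\<lambda>e. e + L e * t) ` {0<..})" if "0 \<le> t" for t
    using L(1) that by (intro bdd_belowI[of _ 0]) auto
  have G_le: "G t \<le> e + L e * t" if "0 \<le> t" "0 < e" for t e
    unfolding G_def using bdd[OF that(1)] that by (intro cINF_lower) auto
  have G_ge: "b \<le> G t" if "\<And>e. 0 < e \<Longrightarrow> b \<le> e + L e * t" for b t
    unfolding G_def using that by (intro cINF_greatest) auto
  have G_nonneg: "0 \<le> G t" if "0 \<le> t" for t
    using L(1) that by (intro G_ge) (simp add: add_nonneg_nonneg)
  have G_mono: "G r \<le> G t" if "0 \<le> r" "r \<le> t" for r t
  proof (rule G_ge)
    fix e :: real assume "0 < e"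
    then show "G r \<le> e + L e * t"
      using G_le[OF that(1) \<open>0 < e\<close>] mult_left_mono[OF that(2) L(1)] by fastforce
  qed
  \<comment> \<open>Multiplying a line's value at \<open>t\<close> by \<open>r / t\<close> turns its
    linear term into that at \<open>r\<close> and can only shrink the intercept.\<close>
  have G_scale: "G t \<le> t / r * G r" if "0 < r" "r \<le> t" for r t
  proof -
    have "r / t * G t \<le> G r"
    proof (rule G_ge)
      fix e :: real assume "0 < e"
      have "r / t * G t \<le> r / t * (e + L e * t)"
        using that by (intro mult_left_mono G_le \<open>0 < e\<close>) auto
      also have "\<dots> = r / t * e + L e * r"
        using that by (simp add: field_simps)
      also have "\<dots> \<le> e + L e * r"
        using that \<open>0 < e\<close> by (simp add: field_simps)
      finally show "r / t * G t \<le> e + L e * r" .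
    qed
    then show ?thesis
      using that by (simp add: field_simps)
  qed
  have "G 0 \<le> 0"
    by (rule field_le_epsilon) (use G_le[of 0] in simp)
  then have G0: "G 0 = 0"
    using G_nonneg[of 0] by simp
  have "(G \<longlongrightarrow> G t) (at t within {0..})" if "t \<in> {0..}" for t
  proof (cases "t = 0")
    case True
    \<comment> \<open>At zero a single line suffices: with intercept \<open>e / 2\<close> it stays
      below \<open>e\<close> nearby.\<close>
    have "(G \<longlongrightarrow> 0) (at 0 within {0..})"
    proof (rule tendstoI)
      fix e :: real assume "0 < e"
      have "((\<lambda>r. e / 2 + L (e / 2) * r) \<longlongrightarrow> e / 2 + L (e / 2) * 0) (at 0 within {0..})"
        by (intro tendsto_intros)
      then have "\<forall>\<^sub>F r in at 0 within {0..}. e / 2 + L (e / 2) * r < e"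
        by (rule order_tendstoD(2)) (use \<open>0 < e\<close> in simp)
      moreover have "\<forall>\<^sub>F r in at 0 within {0..}. r \<in> {0..}"
        by (simp add: eventually_at_filter)
      ultimately show "\<forall>\<^sub>F r in at 0 within {0..}. dist (G r) 0 < e"
      proof eventually_elim
        case (elim r)
        then show ?case
          using G_le[of r "e / 2"] G_nonneg[of r] \<open>0 < e\<close> by simp
      qed
    qed
    then show ?thesis
      using True G0 by simp
  next
    case False
    with that have t: "0 < t" by simp
    \<comment> \<open>Monotonicity gives one bound and scaling the other; \<open>min\<close> and
      \<open>max\<close> merge the cases \<open>r \<le> t\<close> and \<open>t \<le> r\<close> into
      one squeeze.\<close>
    have "(\<lambda>r. min 1 (r / t) * G t) \<midarrow>t\<rightarrow> min 1 (t / t) * G t"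
         "(\<lambda>r. max 1 (r / t) * G t) \<midarrow>t\<rightarrow> max 1 (t / t) * G t"
      using t by (intro tendsto_intros; simp)+
    moreover have "min 1 (r / t) * G t \<le> G r \<and> G r \<le> max 1 (r / t) * G t" if "0 < r" for r
      using G_scale[of r t] G_scale[of t r] G_mono[of r t] G_mono[of t r] t that
      by (cases "r \<le> t") (auto simp: min_def max_def field_simps)
    then have "\<forall>\<^sub>F r in at t. min 1 (r / t) * G t \<le> G r"
        "\<forall>\<^sub>F r in at t. G r \<le> max 1 (r / t) * G t"
      using order_tendstoD(1)[OF tendsto_ident_at t] by (force elim: eventually_mono)+
    ultimately have "G \<midarrow>t\<rightarrow> G t"
      using t by (intro tendsto_sandwich[of "\<lambda>r. min 1 (r / t) * G t" G _ "\<lambda>r. max 1 (r / t) * G t"]) auto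
    then show ?thesis
      using tendsto_within_subset by blast
  qed
  then have "continuous_on {0..} G"
    by (simp add: continuous_on_def)
  then have "class_K (\<lambda>t. t + G t)"
    unfolding class_K_def strict_mono_on_def
    using G0 G_mono by (auto intro!: continuous_intros add_less_le_mono)
  moreover have "v i \<le> s i + G (s i)" if "i \<in> I" for i
    using G_ge[of "v i" "s i"] L(2) that s_nonneg[OF that] by fastforce
  ultimately show ?thesis by blast
qed

section \<open>Compactness, uniformity and averages\<close>

text \<open>Tychonoff: extensional functions form a product over all indices, with the compact
  factor \<open>{undefined}\<close> outside \<open>I\<close>.\<close>

lemma compact_PiE_const:
  fixes U :: "'a::topological_space set"
  assumes "compact U"
  shows "compact (I \<rightarrow>\<^sub>E U)"
proof -
  have eq: "(I \<rightarrow>\<^sub>E U) = (\<Pi>\<^sub>E i\<in>UNIV. if i \<in> I then U else {undefined})"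
    by (auto simp: PiE_iff extensional_def split: if_splits)
  have "compactin (product_topology (\<lambda>i. euclidean) UNIV) (I \<rightarrow>\<^sub>E U)"
    unfolding eq compactin_PiE using assms by auto
  then show ?thesis
    by (simp add: euclidean_product_topology)
qed

text \<open>A tube-lemma argument: compactness is asked of \<open>C\<close> only, while
  \<open>W\<close> enters through a neighbourhood of zero.\<close>

lemma uniformly_continuous_at_zero:
  fixes h :: "'w::real_normed_vector \<Rightarrow> 'c::topological_space \<Rightarrow> real"
  assumes "continuous_on (W \<times> C) (\<lambda>(w, c). h w c)" "compact C" "0 \<in> W" "0 < e"
  shows "\<exists>d>0. \<forall>w\<in>W. norm w \<le> d \<longrightarrow> (\<forall>c\<in>C. \<bar>h w c - h 0 c\<bar> \<le> e)"
proof -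
  obtain S where S: "0 \<in> S" "open S"
      "\<forall>w\<in>S \<inter> W. \<forall>c\<in>C. dist (h w c) (h 0 c) \<le> e"
    using continuous_on_prod_compactE[OF assms] by auto
  then obtain d where "d > 0" "cball 0 d \<subseteq> S"
    using open_contains_cball by blast
  then show ?thesis
    using S(3) by (intro exI[of _ d]) (auto simp: dist_real_def subset_iff)
qed

lemma limsup_average_le:
  fixes h :: "nat \<Rightarrow> real"
  assumes "\<And>T. (\<Sum>k<T. h k) \<le> C + real T * c"
  shows "limsup (\<lambda>T. ereal (1 / real T * (\<Sum>k<T. h k))) \<le> ereal c"
proof -
  have "limsup (\<lambda>T. ereal (1 / real T * (\<Sum>k<T. h k))) \<le> limsup (\<lambda>T. ereal (C / real T + c))"
  \<comment> \<open>Starting at 1 avoids \<open>T = 0\<close>, where both quotients are 0 and the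
    comparison fails for negative \<open>c\<close>.\<close>
  proof (intro Limsup_mono eventually_sequentiallyI[of 1])
    fix T :: nat assume "1 \<le> T"
    then show "ereal (1 / real T * (\<Sum>k<T. h k)) \<le> ereal (C / real T + c)"
      using assms[of T] by (simp add: field_simps)
  qed
  also have "(\<lambda>T. C / real T + c) \<longlonglongrightarrow> 0 + c"
    by (intro tendsto_intros lim_const_over_n)
  then have "limsup (\<lambda>T. ereal (C / real T + c)) = ereal c"
    by (intro lim_imp_Limsup) (auto intro: tendsto_ereal)
  finally show ?thesis .
qed

section \<open>Nominal predictions\<close>

lemma nominal_state_in:
  assumes "\<forall>x\<in>X. \<forall>u\<in>U. f x u 0 \<in> X"
    and "x \<in> X" "v \<in> {..<N} \<rightarrow>\<^sub>E U" "k \<le> N"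
  shows "nominal_state f x v k \<in> X"
  using assms(4)
proof (induction k)
  case (Suc k)
  then show ?case
    using assms(1) PiE_mem[OF assms(3), of k] by simp
qed (use assms(2) in simp)

lemma continuous_on_input: "continuous_on S (\<lambda>p. snd p k)"
  by (rule continuous_on_product_then_coordinatewise[OF continuous_on_snd[OF continuous_on_id]])

text \<open>One-step maps are composed with arguments staying in \<open>X \<times> U\<close>;
  \<open>k \<le> N\<close> confines the inputs used to the tuple, beyond which they are
  \<open>undefined\<close>.\<close>

lemma continuous_on_nominal_state:
  fixes f :: "'x::topological_space \<Rightarrow> 'u::topological_space \<Rightarrow> 'w::{zero,topological_space} \<Rightarrow> 'x"
  assumes f_cont: "continuous_on (X \<times> U) (\<lambda>(x, u). f x u 0)"
    and f_into: "\<forall>x\<in>X. \<forall>u\<in>U. f x u 0 \<in> X"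
    and "k \<le> N"
  shows "continuous_on (X \<times> ({..<N} \<rightarrow>\<^sub>E U)) (\<lambda>(x, v). nominal_state f x v k)"
  using \<open>k \<le> N\<close>
proof (induction k)
  case 0
  then show ?case
    by (auto simp: case_prod_unfold intro: continuous_intros)
next
  case (Suc k)
  have "continuous_on (X \<times> ({..<N} \<rightarrow>\<^sub>E U)) (\<lambda>p. (nominal_state f (fst p) (snd p) k, snd p k))"
    using Suc by (intro continuous_on_Pair continuous_on_input) (simp add: case_prod_unfold)
  then have "continuous_on (X \<times> ({..<N} \<rightarrow>\<^sub>E U))
      (\<lambda>p. (\<lambda>(x, u). f x u 0) (nominal_state f (fst p) (snd p) k, snd p k))"
    by (rule continuous_on_compose2[OF f_cont])
      (use Suc.prems nominal_state_in[where f = f, OF f_into] in \<open>fastforce simp: PiE_iff\<close>)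
  then show ?case
    by (simp add: case_prod_unfold)
qed

lemma continuous_on_mpc_cost:
  fixes f :: "'x::topological_space \<Rightarrow> 'u::topological_space \<Rightarrow> 'w::{zero,topological_space} \<Rightarrow> 'x"
  assumes f_cont: "continuous_on (X \<times> U) (\<lambda>(x, u). f x u 0)"
    and f_into: "\<forall>x\<in>X. \<forall>u\<in>U. f x u 0 \<in> X"
    and l_cont: "continuous_on (X \<times> U) (\<lambda>(x, u). l x u)"
    and Vf_cont: "continuous_on X Vf"
  shows "continuous_on (X \<times> ({..<N} \<rightarrow>\<^sub>E U)) (\<lambda>(x, v). mpc_cost f l Vf N x v)"
proof -
  have into: "nominal_state f (fst p) (snd p) k \<in> X"
    if "p \<in> X \<times> ({..<N} \<rightarrow>\<^sub>E U)" "k \<le> N" for p k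
    using nominal_state_in[where f = f, OF f_into] that by auto
  have state: "continuous_on (X \<times> ({..<N} \<rightarrow>\<^sub>E U)) (\<lambda>p. nominal_state f (fst p) (snd p) k)"
    if "k \<le> N" for k
    using continuous_on_nominal_state[where f = f, OF f_cont f_into that] by (simp add: case_prod_unfold)
  have "continuous_on (X \<times> ({..<N} \<rightarrow>\<^sub>E U))
      (\<lambda>p. (\<lambda>(x, u). l x u) (nominal_state f (fst p) (snd p) k, snd p k))" if "k < N" for k
    using that into
    by (intro continuous_on_compose2[OF l_cont] continuous_on_Pair state continuous_on_input)
      (auto simp: PiE_iff)
  moreover have "continuous_on (X \<times> ({..<N} \<rightarrow>\<^sub>E U)) (\<lambda>p. Vf (nominal_state f (fst p) (snd p) N))"
    using into by (intro continuous_on_compose2[OF Vf_cont] state) auto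
  ultimately show ?thesis
    by (auto simp: mpc_cost_def case_prod_unfold intro!: continuous_intros)
qed

section \<open>The shifted input sequence\<close>

text \<open>The usual MPC candidate for the next time step. The restriction to \<open>{..<N}\<close>
  makes it an extensional tuple, as \<open>feasible_inputs\<close> demands.\<close>

definition shifted_inputs :: "nat \<Rightarrow> (nat \<Rightarrow> 'u) \<Rightarrow> 'u \<Rightarrow> nat \<Rightarrow> 'u" where
  "shifted_inputs N v a = (\<lambda>i\<in>{..<N}. if Suc i < N then v (Suc i) else a)"

lemma shifted_inputs_in:
  assumes "v \<in> {..<N} \<rightarrow>\<^sub>E U" "a \<in> U"
  shows "shifted_inputs N v a \<in> {..<N} \<rightarrow>\<^sub>E U"
  using assms by (auto simp: shifted_inputs_def PiE_iff)

text \<open>The candidate retraces the old prediction one step ahead. The bound is strict because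
  the appended input first acts in the step from \<open>N - 1\<close> to \<open>N\<close>.\<close>

lemma nominal_state_shifted:
  "k < N \<Longrightarrow> nominal_state f (f x (v 0) 0) (shifted_inputs N v a) k = nominal_state f x v (Suc k)"
  by (induction k) (auto simp: shifted_inputs_def)

lemma nominal_state_shifted_final:
  assumes "1 \<le> N"
  shows "nominal_state f (f x (v 0) 0) (shifted_inputs N v a) N = f (nominal_state f x v N) a 0"
proof -
  obtain n where N: "N = Suc n"
    using assms by (cases N) auto
  have "nominal_state f (f x (v 0) 0) (shifted_inputs N v a) n = nominal_state f x v N"
    using nominal_state_shifted[of n N f x v a] by (simp add: N)
  moreover have "shifted_inputs N v a n = a"
    by (simp add: shifted_inputs_def N)
  ultimately show ?thesis
    by (simp add: N)
qed

text \<open>The old stages 1 to \<open>N - 1\<close> occur in both costs and cancel; the dropped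
  first stage, the appended last stage and the terminal costs remain.\<close>

lemma mpc_cost_shifted:
  fixes f :: "'x \<Rightarrow> 'u \<Rightarrow> 'w::zero \<Rightarrow> 'x"
  assumes "1 \<le> N"
    and z: "z = nominal_state f x v N"
  shows "mpc_cost f l Vf N (f x (v 0) 0) (shifted_inputs N v a) =
    mpc_cost f l Vf N x v - l x (v 0) + l z a - Vf z + Vf (f z a 0)"
proof -
  obtain n where N: "N = Suc n"
    using assms by (cases N) auto
  let ?S = "nominal_state f (f x (v 0) 0) (shifted_inputs N v a)"
  have "?S n = z"
    using nominal_state_shifted[of n N f x v a] by (simp add: z N)
  moreover have "(\<Sum>k<n. l (?S k) (shifted_inputs N v a k)) =
      (\<Sum>k<n. l (nominal_state f x v (Suc k)) (v (Suc k)))"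
    by (intro sum.cong refl)
      (use nominal_state_shifted[of _ N f x v a] in \<open>simp add: shifted_inputs_def N\<close>)
  moreover have "(\<Sum>k<N. l (nominal_state f x v k) (v k)) =
      l x (v 0) + (\<Sum>k<n. l (nominal_state f x v (Suc k)) (v (Suc k)))"
    by (simp only: N sum.lessThan_Suc_shift nominal_state.simps(1))
  ultimately show ?thesis
    unfolding mpc_cost_def nominal_state_shifted_final[OF assms(1)]
    by (simp add: z) (simp add: N shifted_inputs_def)
qed

section \<open>Margin in the terminal set\<close>

text \<open>Far from \<open>xs\<close> the decrease is at least a fixed positive amount; near
  \<open>xs\<close> the value is already at most \<open>\<tau> / 2\<close> and does not
  increase.\<close>

lemma lyapunov_uniform_margin:
  fixes V :: "'a::real_normed_vector \<Rightarrow> real"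
  assumes lyap: "lyapunov_function V F S xs" and "0 < \<tau>"
  shows "\<exists>e>0. \<forall>z\<in>S. V z \<le> \<tau> \<longrightarrow> V (F z) \<le> \<tau> - e"
proof -
  obtain a1 a2 a3 where K: "class_K a1" "class_K a2" "class_K a3"
    and decr: "\<And>z. z \<in> S \<Longrightarrow> V z \<le> a2 (norm (z - xs))"
      "\<And>z. z \<in> S \<Longrightarrow> V (F z) \<le> V z - a3 (norm (z - xs))"
    using lyap unfolding lyapunov_function_def class_K_inf_def by blast
  have mono: "a r \<le> a t" if "class_K a" "0 \<le> r" "r \<le> t" for a and r t :: real
    using that strict_mono_onD[of "{0..}" a r t] unfolding class_K_def
    by (cases "r = t") force+
  have "(a2 \<longlongrightarrow> 0) (at 0 within {0..})"
    using K(2) unfolding class_K_def continuous_on_def by force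
  then have "\<forall>\<^sub>F r in at 0 within {0..}. a2 r < \<tau> / 2"
    by (rule order_tendstoD(2)) (use \<open>0 < \<tau>\<close> in simp)
  then obtain d where d: "d > 0" "\<And>r. 0 < r \<Longrightarrow> r < d \<Longrightarrow> a2 r < \<tau> / 2"
    unfolding eventually_at by (force simp: dist_real_def)
  \<comment> \<open>Halving puts the radius itself where \<open>a2\<close> is below
    \<open>\<tau> / 2\<close>; monotonicity covers all smaller distances, including zero.\<close>
  define r where "r = d / 2"
  have r: "0 < r" "a2 r < \<tau> / 2"
    using d by (auto simp: r_def)
  have "0 < a3 r"
    using K(3) r(1) strict_mono_onD[of "{0..}" a3 0 r] unfolding class_K_def by auto
  have "V (F z) \<le> \<tau> - min (\<tau> / 2) (a3 r)" if z: "z \<in> S" "V z \<le> \<tau>" for z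
  proof (cases "r \<le> norm (z - xs)")
    case True
    then show ?thesis
      using decr(2)[OF z(1)] z(2) mono[OF K(3), of r] r(1) by fastforce
  next
    case False
    then have "V z \<le> \<tau> / 2"
      using decr(1)[OF z(1)] mono[OF K(2), of "norm (z - xs)" r] r by force
    moreover have "0 \<le> a3 (norm (z - xs))"
      using mono[OF K(3), of 0 "norm (z - xs)"] K(3) by (simp add: class_K_def)
    ultimately show ?thesis
      using decr(2)[OF z(1)] by linarith
  qed
  then show ?thesis
    using \<open>0 < \<tau>\<close> \<open>0 < a3 r\<close> by (intro exI[of _ "min (\<tau> / 2) (a3 r)"]) auto
qed

theorem theorem10:
  fixes X Xf Xs XX :: "(real ^ 'n) set"
    and U :: "(real ^ 'm) set"
    and W :: "(real ^ 'q) set"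
    and f :: "real ^ 'n \<Rightarrow> real ^ 'm \<Rightarrow> real ^ 'q \<Rightarrow> real ^ 'n"
    and le g l :: "real ^ 'n \<Rightarrow> real ^ 'm \<Rightarrow> real"
    and lam \<tau> :: real
    and N :: nat
    and xs :: "real ^ 'n" and us :: "real ^ 'm"
    and Vf Vs :: "real ^ 'n \<Rightarrow> real"
    and u0 :: "real ^ 'n \<Rightarrow> nat \<Rightarrow> real ^ 'm"
    and \<kappa> \<kappa>f :: "real ^ 'n \<Rightarrow> real ^ 'm"
  assumes W_zero: "0 \<in> W"
    and f_into: "\<And>x u w. x \<in> X \<Longrightarrow> u \<in> U \<Longrightarrow> w \<in> W \<Longrightarrow> f x u w \<in> X"
    and lam_pos: "lam > 0"
    and g_cont: "continuous_on (X \<times> U) (\<lambda>(x, u). g x u)"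
    and l_eq: "l = stage_cost le lam g"
    and N_pos: "N \<ge> 1"
    and XX_eq: "XX = feasible_set f X U N Xf"
    and u0_opt: "optimal_selection f X U N Xf l Vf u0"
    and \<kappa>_eq: "\<kappa> = (\<lambda>x. u0 x 0)"
    and f_cont: "continuous_on (X \<times> U \<times> W) (\<lambda>(x, u, w). f x u w)"
    and l_cont: "continuous_on (X \<times> U) (\<lambda>(x, u). l x u)"
    and U_compact: "compact U"
    and X_closed: "closed X"
    and XX_bounded: "bounded XX"
    and xs_in: "xs \<in> X" and us_in: "us \<in> U"
    and steady: "xs = f xs us 0"
    and Xs_sub: "Xs \<subseteq> X" and xs_Xs: "xs \<in> Xs"
    and \<kappa>f_into: "\<And>x. x \<in> Xs \<Longrightarrow> \<kappa>f x \<in> U"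
    and Xs_inv: "positive_invariant Xs (\<lambda>x. f x (\<kappa>f x) 0)"
    and Vs_cont: "continuous_on X Vs"
    and Vs_nonneg: "\<And>x. x \<in> X \<Longrightarrow> Vs x \<ge> 0"
    and Vs_lyap: "lyapunov_function Vs (\<lambda>x. f x (\<kappa>f x) 0) Xs xs"
    and Xf_eq: "Xf = {x \<in> X. Vs x \<le> \<tau>}"
    and \<tau>_pos: "\<tau> > 0"
    and Xf_sub: "Xf \<subseteq> Xs"
    and Vf_cont: "continuous_on X Vf"
    and Vf_decrease: "\<And>x. x \<in> Xf \<Longrightarrow> Vf (f x (\<kappa>f x) 0) \<le> Vf x - l x (\<kappa>f x) + l xs us"
  shows "\<exists>\<delta>>0. \<exists>\<gamma>. class_K \<gamma> \<and>
           robustly_positive_invariant XX {w \<in> W. norm w \<le> \<delta>} (\<lambda>x w. f x (\<kappa> x) w) \<and>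
           (\<forall>x\<in>XX. \<forall>w. (\<forall>k. w k \<in> {w \<in> W. norm w \<le> \<delta>}) \<longrightarrow>
              limsup (\<lambda>T. ereal (1 / real T * (\<Sum>k<T. l (closed_loop_state f \<kappa> x w k)
                                                  (\<kappa> (closed_loop_state f \<kappa> x w k)))))
              \<le> ereal (l xs us + \<gamma> (sup_norm w)))"
proof -

  \<comment> \<open>Optimal inputs and the candidate\<close>
  let ?P = "{..<N} \<rightarrow>\<^sub>E U"
  let ?V = "mpc_cost f l Vf N"
  have f0_cont: "continuous_on (X \<times> U) (\<lambda>(x, u). f x u 0)"
  proof -
    have "continuous_on (X \<times> U) (\<lambda>p. (\<lambda>(x, u, w). f x u w) (fst p, snd p, 0))"
      by (rule continuous_on_compose2[OF f_cont]) (auto intro!: continuous_intros simp: W_zero)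
    then show ?thesis by (simp add: case_prod_unfold)
  qed
  have f0_into: "\<forall>x\<in>X. \<forall>u\<in>U. f x u 0 \<in> X"
    using f_into W_zero by blast
  note state_in = nominal_state_in[where f = f, OF f0_into]
  have XX_sub: "XX \<subseteq> X"
    by (auto simp: XX_eq feasible_set_def)
  \<comment> \<open>The closure supplies compactness without a proof that \<open>XX\<close> is
    closed, and stays inside the closed set \<open>X\<close>.\<close>
  define K where "K = closure XX"
  have K: "compact K" "K \<subseteq> X" "XX \<subseteq> K"
    using XX_bounded closure_minimal[OF XX_sub X_closed] closure_subset[of XX]
    by (simp_all add: K_def compact_closure)
  have P_compact: "compact ?P"
    by (rule compact_PiE_const[OF U_compact])
  have opt: "u0 x \<in> ?P" "nominal_state f x (u0 x) N \<in> Xf" "\<kappa> x \<in> U"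
    "\<And>v. v \<in> ?P \<Longrightarrow> nominal_state f x v N \<in> Xf \<Longrightarrow> ?V x (u0 x) \<le> ?V x v" if "x \<in> XX" for x
  proof -
    have *: "is_arg_min (?V x) (\<lambda>v. v \<in> feasible_inputs f U N Xf x) (u0 x)"
      using u0_opt that unfolding optimal_selection_def XX_eq by blast
    show **: "u0 x \<in> ?P" and "nominal_state f x (u0 x) N \<in> Xf"
      using * by (auto simp: is_arg_min_def feasible_inputs_def)
    show "\<kappa> x \<in> U"
      using ** N_pos by (auto simp: \<kappa>_eq PiE_iff)
    show "?V x (u0 x) \<le> ?V x v" if "v \<in> ?P" "nominal_state f x v N \<in> Xf" for v
      using * that by (auto simp: is_arg_min_linorder feasible_inputs_def)
  qed
  \<comment> \<open>The candidate \<open>v x\<close> is built from the nominal terminal state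
    \<open>z x\<close>, so it does not depend on the disturbance.\<close>
  define z where "z x = nominal_state f x (u0 x) N" for x
  define v where "v x = shifted_inputs N (u0 x) (\<kappa>f (z x))" for x
  have z: "z x \<in> Xf" "\<kappa>f (z x) \<in> U" "v x \<in> ?P" if "x \<in> XX" for x
  proof -
    show "z x \<in> Xf"
      using opt(2)[OF that] by (simp add: z_def)
    then show "\<kappa>f (z x) \<in> U"
      using Xf_sub \<kappa>f_into by blast
    then show "v x \<in> ?P"
      unfolding v_def by (rule shifted_inputs_in[OF opt(1)[OF that]])
  qed

  \<comment> \<open>Uniformity in the disturbance\<close>
  \<comment> \<open>The control laws may be discontinuous in \<open>x\<close>. Input and sequence
    are therefore free variables over compact sets, and \<open>uniform_next\<close> inserts
    \<open>\<kappa> x\<close> and \<open>v x\<close> only afterwards.\<close>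
  have cont_next: "continuous_on (W \<times> (K \<times> U \<times> ?P)) (\<lambda>(w, (x, a, q)). H (f x a w) q)"
    if H: "continuous_on (X \<times> ?P) (\<lambda>(x, q). H x q)" for H :: "_ \<Rightarrow> _ \<Rightarrow> real"
  proof -
    let ?D = "W \<times> (K \<times> U \<times> ?P)"
    have "continuous_on ?D
        (\<lambda>p. (\<lambda>(x, a, w). f x a w) (fst (snd p), fst (snd (snd p)), fst p))"
      by (rule continuous_on_compose2[OF f_cont]) (use K(2) in \<open>auto intro!: continuous_intros\<close>)
    then have "continuous_on ?D
        (\<lambda>p. (f (fst (snd p)) (fst (snd (snd p))) (fst p), snd (snd (snd p))))"
      by (auto intro!: continuous_on_Pair continuous_on_snd continuous_on_id)
    then have "continuous_on ?D
        (\<lambda>p. (\<lambda>(x, q). H x q) (f (fst (snd p)) (fst (snd (snd p))) (fst p), snd (snd (snd p))))"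
      by (rule continuous_on_compose2[OF H]) (use K(2) f_into in auto)
    then show ?thesis by (simp add: case_prod_unfold)
  qed
  have uniform_next: "\<exists>d>0. \<forall>w\<in>W. norm w \<le> d \<longrightarrow>
      (\<forall>x\<in>XX. \<bar>H (f x (\<kappa> x) w) (v x) - H (f x (\<kappa> x) 0) (v x)\<bar> \<le> e)"
    if H: "continuous_on (X \<times> ?P) (\<lambda>(x, q). H x q)" and e: "0 < e"
    for H :: "_ \<Rightarrow> _ \<Rightarrow> real" and e
  proof -
    obtain d where d: "d > 0" "\<forall>w\<in>W. norm w \<le> d \<longrightarrow> (\<forall>c\<in>K \<times> U \<times> ?P.
        \<bar>(\<lambda>(x, a, q). H (f x a w) q) c - (\<lambda>(x, a, q). H (f x a 0) q) c\<bar> \<le> e)"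
      using uniformly_continuous_at_zero[where h = "\<lambda>w (x, a, q). H (f x a w) q",
          OF cont_next[OF H] _ W_zero e]
        compact_Times[OF K(1) compact_Times[OF U_compact P_compact]] by blast
    have "(x, \<kappa> x, v x) \<in> K \<times> U \<times> ?P" if "x \<in> XX" for x
      using that opt(3) z(3) K(3) by auto
    then show ?thesis
      using d by (intro exI[of _ d]) fastforce
  qed

  \<comment> \<open>Robust recursive feasibility\<close>
  obtain e where e: "e > 0" "\<And>y. y \<in> Xf \<Longrightarrow> Vs (f y (\<kappa>f y) 0) \<le> \<tau> - e"
    using lyapunov_uniform_margin[OF Vs_lyap \<tau>_pos] Xf_sub Xf_eq by blast
  have "continuous_on (X \<times> ?P) (\<lambda>p. Vs ((\<lambda>(x, q). nominal_state f x q N) p))"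
    using state_in
    by (intro continuous_on_compose2[OF Vs_cont] continuous_on_nominal_state f0_cont f0_into) auto
  then have "continuous_on (X \<times> ?P) (\<lambda>(x, q). Vs (nominal_state f x q N))"
    by (simp add: case_prod_unfold)
  \<comment> \<open>The tolerance equals the margin \<open>e\<close>, so the disturbed terminal
    value is still at most \<open>\<tau>\<close>.\<close>
  from uniform_next[OF this e(1)] obtain d1 where d1: "d1 > 0"
    "\<And>w x. w \<in> W \<Longrightarrow> norm w \<le> d1 \<Longrightarrow> x \<in> XX \<Longrightarrow>
      Vs (nominal_state f (f x (\<kappa> x) w) (v x) N) \<le> Vs (nominal_state f (f x (\<kappa> x) 0) (v x) N) + e"
    by (fastforce simp: abs_le_iff algebra_simps)
  have v_final: "nominal_state f (f x (\<kappa> x) 0) (v x) N = f (z x) (\<kappa>f (z x)) 0" for x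
    using nominal_state_shifted_final[OF N_pos, of f x "u0 x"] by (simp add: v_def z_def \<kappa>_eq)
  have next_in: "f x (\<kappa> x) w \<in> X" if "x \<in> XX" "w \<in> W" for x w
    using f_into opt(3) XX_sub that by blast
  have next_terminal: "nominal_state f (f x (\<kappa> x) w) (v x) N \<in> Xf"
    if "x \<in> XX" "w \<in> W" "norm w \<le> d1" for x w
    using d1(2)[of w x] e(2)[OF z(1)[of x]] that state_in[OF next_in z(3)] v_final[of x]
    by (force simp: Xf_eq)
  have invariant: "f x (\<kappa> x) w \<in> XX" if "x \<in> XX" "w \<in> W" "norm w \<le> d1" for x w
    using next_terminal[OF that] next_in[of x w] z(3)[of x] that
    by (auto simp: XX_eq feasible_set_def feasible_inputs_def)

  \<comment> \<open>Disturbance gain and cost decrease\<close>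
  have V_cont: "continuous_on (X \<times> ?P) (\<lambda>(x, q). ?V x q)"
    by (intro continuous_on_mpc_cost f0_cont f0_into l_cont Vf_cont)
  define \<Delta> where "\<Delta> w x = ?V (f x (\<kappa> x) w) (v x) - ?V (f x (\<kappa> x) 0) (v x)" for w x
  have \<Delta>_small: "\<exists>d>0. \<forall>w\<in>W. norm w \<le> d \<longrightarrow> (\<forall>x\<in>XX. \<Delta> w x \<le> e)" if "0 < e" for e
    using uniform_next[OF V_cont that] unfolding \<Delta>_def abs_le_iff by blast
  \<comment> \<open>The value 1 is arbitrary: it provides the uniform upper bound asked for by
    \<open>class_K_majorant\<close>.\<close>
  obtain d2 where d2: "d2 > 0" "\<And>w x. w \<in> W \<Longrightarrow> norm w \<le> d2 \<Longrightarrow> x \<in> XX \<Longrightarrow> \<Delta> w x \<le> 1"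
    using \<Delta>_small[of 1] by auto
  define \<delta> where "\<delta> = min d1 d2"
  have \<delta>: "0 < \<delta>" "\<delta> \<le> d1" "\<delta> \<le> d2"
    using d1(1) d2(1) by (auto simp: \<delta>_def)
  \<comment> \<open>Indexing by disturbance and state together yields one gain for all feasible
    states.\<close>
  define I where "I = {w \<in> W. norm w \<le> \<delta>} \<times> XX"
  have "\<exists>\<gamma>. class_K \<gamma> \<and> (\<forall>i\<in>I. (\<lambda>(w, x). \<Delta> w x) i \<le> \<gamma> (norm (fst i)))"
  proof (rule class_K_majorant)
    show "(\<lambda>(w, x). \<Delta> w x) i \<le> 1" if "i \<in> I" for i
      using that d2(2) \<delta> by (auto simp: I_def)
    show "\<exists>d>0. \<forall>i\<in>I. norm (fst i) \<le> d \<longrightarrow> (\<lambda>(w, x). \<Delta> w x) i \<le> e" if "0 < e" for e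
      using \<Delta>_small[OF that] by (force simp: I_def)
  qed auto
  then obtain \<gamma> where \<gamma>: "class_K \<gamma>"
    "\<And>w x. w \<in> W \<Longrightarrow> norm w \<le> \<delta> \<Longrightarrow> x \<in> XX \<Longrightarrow> \<Delta> w x \<le> \<gamma> (norm w)"
    by (force simp: I_def)
  have \<gamma>_mono: "\<gamma> r \<le> \<gamma> t" if "0 \<le> r" "r \<le> t" for r t
    using that \<gamma>(1) strict_mono_onD[of "{0..}" \<gamma> r t] unfolding class_K_def
    by (cases "r = t") force+

  \<comment> \<open>The candidate is feasible at the disturbed successor, so its cost bounds the
    optimal one there. The gain absorbs the disturbance, and the terminal inequality trades the
    appended stage for \<open>l xs us\<close>.\<close>
  have decrease: "?V (f x (\<kappa> x) w) (u0 (f x (\<kappa> x) w)) \<le> ?V x (u0 x) - l x (\<kappa> x) + l xs us + \<gamma> (norm w)"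
    if "x \<in> XX" "w \<in> W" "norm w \<le> \<delta>" for x w
  proof -
    have w: "norm w \<le> d1" using that \<delta> by simp
    have "?V (f x (\<kappa> x) w) (u0 (f x (\<kappa> x) w)) \<le> ?V (f x (\<kappa> x) w) (v x)"
      using that w by (intro opt(4) invariant next_terminal z(3))
    also have "\<dots> \<le> ?V (f x (\<kappa> x) 0) (v x) + \<gamma> (norm w)"
      using \<gamma>(2)[OF that(2,3,1)] by (simp add: \<Delta>_def)
    also have "?V (f x (\<kappa> x) 0) (v x) =
        ?V x (u0 x) - l x (\<kappa> x) + l (z x) (\<kappa>f (z x)) - Vf (z x) + Vf (f (z x) (\<kappa>f (z x)) 0)"
      using mpc_cost_shifted[where f = f and x = x and v = "u0 x" and l = l and Vf = Vf, OF N_pos refl]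
      by (simp add: \<kappa>_eq v_def z_def)
    finally show ?thesis
      using Vf_decrease[OF z(1)[OF that(1)]] by linarith
  qed
  \<comment> \<open>The stage cost has no definite sign, so a two-sided bound is sought. It comes
    from the jointly continuous cost, without continuity of the optimal value.\<close>
  have "compact ((\<lambda>(x, q). ?V x q) ` (K \<times> ?P))"
    using K by (intro compact_continuous_image compact_Times P_compact
        continuous_on_subset[OF V_cont]) auto
  from compact_imp_bounded[OF this] obtain B where
    "\<forall>y\<in>(\<lambda>(x, q). ?V x q) ` (K \<times> ?P). norm y \<le> B"
    unfolding bounded_iff by blast
  then have B: "\<bar>?V x (u0 x)\<bar> \<le> B" if "x \<in> XX" for x
    using K(3) opt(1)[OF that] that by fastforce

  \<comment> \<open>Average performance\<close>
  have average: "limsup (\<lambda>T. ereal (1 / real T * (\<Sum>k<T. l (closed_loop_state f \<kappa> x w k)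
        (\<kappa> (closed_loop_state f \<kappa> x w k))))) \<le> ereal (l xs us + \<gamma> (sup_norm w))"
    if x: "x \<in> XX" and w: "\<And>k. w k \<in> W" "\<And>k. norm (w k) \<le> \<delta>" for x w
  proof (rule limsup_average_le)
    fix T
    let ?x = "closed_loop_state f \<kappa> x w"
    let ?V0 = "\<lambda>y. ?V y (u0 y)"
    have x_in: "?x k \<in> XX" for k
    proof (induction k)
      case (Suc k)
      then show ?case
        using invariant[of "?x k" "w k"] w[of k] \<delta>(2) by simp
    qed (simp add: x)
    \<comment> \<open>The bound \<open>\<delta>\<close> makes the real supremum meaningful.\<close>
    have "norm (w k) \<le> sup_norm w" for k
      unfolding sup_norm_def using w(2) by (intro cSUP_upper bdd_aboveI2[of _ _ \<delta>]) auto
    then have "l (?x k) (\<kappa> (?x k)) \<le> ?V0 (?x k) - ?V0 (?x (Suc k)) + (l xs us + \<gamma> (sup_norm w))" for k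
      using decrease[OF x_in w, of k k] \<gamma>_mono[of "norm (w k)" "sup_norm w"] by fastforce
    then have "(\<Sum>k<T. l (?x k) (\<kappa> (?x k))) \<le>
        (\<Sum>k<T. ?V0 (?x k) - ?V0 (?x (Suc k)) + (l xs us + \<gamma> (sup_norm w)))"
      by (intro sum_mono)
    \<comment> \<open>Optimal costs telescope to the two end values, each of modulus at most
      \<open>B\<close>; hence the constant \<open>2 * B\<close>.\<close>
    also have "\<dots> = ?V0 (?x 0) - ?V0 (?x T) + real T * (l xs us + \<gamma> (sup_norm w))"
      by (simp only: sum.distrib sum_lessThan_telescope'[of "\<lambda>k. ?V0 (?x k)"] sum_constant
          card_lessThan distrib_left)
    also have "\<dots> \<le> 2 * B + real T * (l xs us + \<gamma> (sup_norm w))"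
      using B[OF x_in, of 0] B[OF x_in, of T] by linarith
    finally show "(\<Sum>k<T. l (?x k) (\<kappa> (?x k))) \<le> 2 * B + real T * (l xs us + \<gamma> (sup_norm w))" .
  qed
  have "robustly_positive_invariant XX {w \<in> W. norm w \<le> \<delta>} (\<lambda>x w. f x (\<kappa> x) w)"
    using invariant \<delta>(2) by (auto simp: robustly_positive_invariant_def)
  with average \<delta>(1) \<gamma>(1) show ?thesis
    by (intro exI[of _ \<delta>] exI[of _ \<gamma>]) auto
qed

end
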